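(* For either choice of the sign, $$\gamma_{1,-1,\pm3}(3)=\frac{47}{122},\qquad \gamma_{1,1,\pm 3}(3)=\frac{5}{13}.$$
   Context: For $\alpha,\beta,\gamma\ge 0$, let $G(\alpha,\beta,\gamma)$ be the area of the region $\{(x,y)\in\mathbb{R}^2: |x|\le \alpha/2,\ |y|\le\beta/2,\ |x+y|\le\gamma/2\}$. For nonzero integers $a_1,a_2,a_3$ with $\gcd(a_1,a_2,a_3)=1$, a positive integer $q$ and a function $g:\mathbb{Z}/q\mathbb{Z}\to[0,1]$ with $\sum_r g(r)=1$, define $$\gamma_{a_1,a_2,a_3}(g)=\frac{1}{|a_1a_2a_3|}\sum_{\substack{r_1,r_2,r_3 \in \mathbb{Z}/q\mathbb{Z}\\ a_1r_1+a_2r_2+a_3r_3\equiv 0 \ (\mathrm{mod}\ q)}}G(|a_1|g(r_1),|a_2|g(r_2),|a_3|g(r_3)).$$ Let $\gamma_{a_1,a_2,a_3}(q)$ be the maximum of $\gamma_{a_1,a_2,a_3}(g)$ over all functions $g:\mathbb{Z}/q\mathbb{Z}\to[0,1]$ with $\sum_r g(r)=1$. *)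

theory Defs
  imports "HOL-Analysis.Analysis" "HOL-Number_Theory.Cong"
begin

definition hex_area :: "real \<Rightarrow> real \<Rightarrow> real \<Rightarrow> real" where
  "hex_area \<alpha> \<beta> \<gamma> =
     measure lborel {(x::real, y::real). \<bar>x\<bar> \<le> \<alpha> / 2 \<and> \<bar>y\<bar> \<le> \<beta> / 2 \<and> \<bar>x + y\<bar> \<le> \<gamma> / 2}"

text \<open>
  The ring of residues modulo \<open>q\<close> is represented by \<open>{0..<int q}\<close>. A function on it is a function on
  \<open>int\<close> of which only the values on \<open>{0..<int q}\<close> are used.
\<close>

definition densities :: "nat \<Rightarrow> (int \<Rightarrow> real) set" where
  "densities q = {g. g \<in> {0..<int q} \<rightarrow> {0..1} \<and> (\<Sum>r\<in>{0..<int q}. g r) = 1}"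

definition residue_solutions :: "int \<Rightarrow> int \<Rightarrow> int \<Rightarrow> nat \<Rightarrow> (int \<times> int \<times> int) set" where
  "residue_solutions a1 a2 a3 q =
     {(r1, r2, r3) \<in> {0..<int q} \<times> {0..<int q} \<times> {0..<int q}.
        [a1 * r1 + a2 * r2 + a3 * r3 = 0] (mod int q)}"

text \<open>
  The following two definitions are meant for nonzero \<open>a1\<close>, \<open>a2\<close>, \<open>a3\<close> with greatest common divisor 1
  and \<open>q > 0\<close>.
\<close>

definition gamma_density :: "int \<Rightarrow> int \<Rightarrow> int \<Rightarrow> nat \<Rightarrow> (int \<Rightarrow> real) \<Rightarrow> real" where
  "gamma_density a1 a2 a3 q g =
     1 / real_of_int \<bar>a1 * a2 * a3\<bar> *
     (\<Sum>(r1, r2, r3)\<in>residue_solutions a1 a2 a3 q.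
        hex_area (real_of_int \<bar>a1\<bar> * g r1) (real_of_int \<bar>a2\<bar> * g r2) (real_of_int \<bar>a3\<bar> * g r3))"

text \<open>
  \<open>is_gamma a1 a2 a3 q m\<close> says that the maximum defining \<open>\<gamma>(q)\<close> exists (is attained) and equals \<open>m\<close>.
\<close>

definition is_gamma :: "int \<Rightarrow> int \<Rightarrow> int \<Rightarrow> nat \<Rightarrow> real \<Rightarrow> bool" where
  "is_gamma a1 a2 a3 q m \<longleftrightarrow>
     m \<in> gamma_density a1 a2 a3 q ` densities q \<and>
     (\<forall>g\<in>densities q. gamma_density a1 a2 a3 q g \<le> m)"

end

theory Submission
  imports Defs
begin

text \<open>
  The region defining \<open>hex_area a b c\<close> is a rectangle with two opposite corner triangles removed, so
  \<open>hex_area a a c = a\<^sup>2 - (max 0 (a - c / 2))\<^sup>2\<close>. For coefficients 1, -1, 3 or -3 only such diagonal values occur,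
  and the problem is to maximize a piecewise quadratic function on the simplex. Sort the values of the
  density; on the cell that contains the maximizer (42, 12, 7) / 61 the function is a quadratic form that is
  concave on the simplex, and on the other cells the bound follows from squares and from products of the
  inequalities that define the cell. For coefficients 1, 1, 3 or -3 the
  value \<open>hex_area a b c\<close> is at most its value with \<open>a\<close> and \<open>b\<close> replaced by their mean, so one may
  assume \<open>g 1 = g 2\<close>, which leaves a problem in one parameter with maximizer (9, 2, 2) / 13.
\<close>

section \<open>The area of the hexagon\<close>

text \<open>Tonelli in both orders: vertical slices compute the corner triangles, horizontal ones
  give the bound by \<open>b * c\<close>, and comparing the two gives the symmetry of
  \<open>hex_area\<close>.\<close>

lemma emeasure_lborel_pair_slices:
  fixes S :: "(real \<times> real) set"
  assumes "S \<in> sets borel"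
  shows "emeasure lborel S = (\<integral>\<^sup>+x. emeasure lborel {y. (x, y) \<in> S} \<partial>lborel)"
    and "emeasure lborel S = (\<integral>\<^sup>+y. emeasure lborel {x. (x, y) \<in> S} \<partial>lborel)"
proof -
  have "S \<in> sets (lborel \<Otimes>\<^sub>M lborel)"
    using assms by (simp flip: borel_prod)
  then show "emeasure lborel S = (\<integral>\<^sup>+x. emeasure lborel {y. (x, y) \<in> S} \<partial>lborel)"
    and "emeasure lborel S = (\<integral>\<^sup>+y. emeasure lborel {x. (x, y) \<in> S} \<partial>lborel)"
    using lborel.emeasure_pair_measure_alt[of S lborel]
      lborel_pair.emeasure_pair_measure_alt2[of S]
    by (simp_all add: lborel_prod vimage_def)
qed

lemma sets_corner_triangle:
  fixes A B C :: real
  shows "{(x, y). x \<le> A \<and> y \<le> B \<and> C < x + y} \<in> sets borel"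
proof -
  have "{(x, y). x \<le> A \<and> y \<le> B \<and> C < x + y}
      = {p \<in> space (borel \<Otimes>\<^sub>M borel). fst p \<le> A \<and> snd p \<le> B \<and> C < fst p + snd p}"
    by (auto simp: space_pair_measure)
  also have "\<dots> \<in> sets (borel \<Otimes>\<^sub>M borel)"
    by measurable
  finally show ?thesis
    by (simp flip: borel_prod)
qed

text \<open>Integrates the lengths \<open>x - (C - B)\<close> of the vertical slices over
  \<open>{C - B..A}\<close>, which the hypothesis makes nonempty. The strict
  \<open>C < x + y\<close> makes the removed triangles exactly the complement of the closed hexagon
  in its rectangle.\<close>

lemma measure_corner_triangle:
  fixes A B C :: real
  assumes "C \<le> A + B"
  shows "measure lborel {(x, y). x \<le> A \<and> y \<le> B \<and> C < x + y} = (A + B - C)\<^sup>2 / 2"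
proof -
  let ?T = "{(x, y). x \<le> A \<and> y \<le> B \<and> C < x + y}"
  have "?T \<in> sets borel"
    by (rule sets_corner_triangle)
  moreover have "emeasure lborel {y. (x, y) \<in> ?T}
      = ennreal (x - (C - B)) * indicator {C - B..A} x" for x
  proof (cases "x \<in> {C - B..A}")
    case True
    then have "{y. (x, y) \<in> ?T} = {C - x<..B}"
      by auto
    then show ?thesis
      using True by (simp add: algebra_simps)
  next
    case False
    then have "{y. (x, y) \<in> ?T} = {}"
      by auto
    then show ?thesis
      using False by (simp only: emeasure_empty) simp
  qed
  ultimately have "emeasure lborel ?T
      = (\<integral>\<^sup>+x. ennreal (x - (C - B)) * indicator {C - B..A} x \<partial>lborel)"
    by (subst emeasure_lborel_pair_slices(1)) auto
  also have "\<dots> = ennreal ((A - (C - B))\<^sup>2 / 2 - (C - B - (C - B))\<^sup>2 / 2)"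
    using assms
    by (intro nn_integral_FTC_Icc) (auto intro!: derivative_eq_intros)
  finally show ?thesis
    by (simp add: measure_def algebra_simps)
qed
lemma image_uminus_eq: "uminus ` S = {x. - x \<in> S}" for S :: "'a::group_add set"
  by (metis (no_types, lifting) minus_minus image_iff mem_Collect_eq subsetI subset_antisym)

lemma measure_lborel_uminus:
  fixes S :: "'a::euclidean_space set"
  assumes "S \<in> sets borel" "uminus ` S \<in> sets borel"
  shows "measure lborel (uminus ` S) = measure lborel S"
  using measure_lebesgue_affine[of "-1" 0 S] assms by (simp add: measure_completion)

lemma sets_hexagon:
  fixes a b c :: real
  shows "{(x, y). \<bar>x\<bar> \<le> a \<and> \<bar>y\<bar> \<le> b \<and> \<bar>x + y\<bar> \<le> c} \<in> sets borel"
proof -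
  have "{(x, y). \<bar>x\<bar> \<le> a \<and> \<bar>y\<bar> \<le> b \<and> \<bar>x + y\<bar> \<le> c}
      = {p \<in> space (borel \<Otimes>\<^sub>M borel). \<bar>fst p\<bar> \<le> a \<and> \<bar>snd p\<bar> \<le> b \<and> \<bar>fst p + snd p\<bar> \<le> c}"
    by (auto simp: space_pair_measure)
  also have "\<dots> \<in> sets (borel \<Otimes>\<^sub>M borel)"
    by measurable
  finally show ?thesis
    by (simp flip: borel_prod)
qed

lemma hex_area_commute: "hex_area a b c = hex_area b a c"
  unfolding hex_area_def measure_def
  by (subst emeasure_lborel_pair_slices(1), rule sets_hexagon,
      subst emeasure_lborel_pair_slices(2), rule sets_hexagon)
    (simp add: add.commute conj_left_commute)

lemma measure_rectangle:
  fixes a b :: real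
  assumes "0 \<le> a" "0 \<le> b"
  shows "{(x::real, y::real). \<bar>x\<bar> \<le> a / 2 \<and> \<bar>y\<bar> \<le> b / 2} \<in> fmeasurable lborel"
    and "measure lborel {(x::real, y::real). \<bar>x\<bar> \<le> a / 2 \<and> \<bar>y\<bar> \<le> b / 2} = a * b"
proof -
  have *: "{(x::real, y::real). \<bar>x\<bar> \<le> a / 2 \<and> \<bar>y\<bar> \<le> b / 2} = cbox (- a / 2, - b / 2) (a / 2, b / 2)"
    by (auto simp: cbox_Pair_eq abs_le_iff)
  show "{(x::real, y::real). \<bar>x\<bar> \<le> a / 2 \<and> \<bar>y\<bar> \<le> b / 2} \<in> fmeasurable lborel"
    unfolding * by simp
  show "measure lborel {(x::real, y::real). \<bar>x\<bar> \<le> a / 2 \<and> \<bar>y\<bar> \<le> b / 2} = a * b"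
    unfolding * using assms by (simp add: content_Pair)
qed

text \<open>Each nonempty horizontal slice lies in an interval of length \<open>c\<close>, and the
  heights fill an interval of length \<open>b\<close>. This serves the case where \<open>c\<close>
  is so small that the corner triangles leave the rectangle.\<close>

lemma hex_area_le_mult_third:
  assumes "0 \<le> b" "0 \<le> c"
  shows "hex_area a b c \<le> b * c"
proof -
  let ?H = "{(x::real, y::real). \<bar>x\<bar> \<le> a / 2 \<and> \<bar>y\<bar> \<le> b / 2 \<and> \<bar>x + y\<bar> \<le> c / 2}"
  have slice_le: "emeasure lborel {x. (x, y) \<in> ?H} \<le> ennreal c * indicator {- b / 2..b / 2} y" for y
  proof (cases "y \<in> {- b / 2..b / 2}")
    case True
    have "emeasure lborel {x. (x, y) \<in> ?H} \<le> emeasure lborel {- c / 2 - y..c / 2 - y}"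
      by (intro emeasure_mono) (auto simp: abs_if split: if_splits)
    then show ?thesis
      using True assms by simp
  next
    case False
    then have "{x. (x, y) \<in> ?H} = {}"
      by auto
    then show ?thesis
      by (simp only: emeasure_empty) simp
  qed
  have "emeasure lborel ?H = (\<integral>\<^sup>+y. emeasure lborel {x. (x, y) \<in> ?H} \<partial>lborel)"
    by (rule emeasure_lborel_pair_slices(2)[OF sets_hexagon])
  also have "\<dots> \<le> (\<integral>\<^sup>+y. ennreal c * indicator {- b / 2..b / 2} y \<partial>lborel)"
    by (intro nn_integral_mono slice_le)
  also have "\<dots> = ennreal (b * c)"
    using assms by (simp add: nn_integral_cmult_indicator ennreal_mult mult.commute)
  finally show ?thesis
    using assms unfolding hex_area_def measure_def by (simp add: enn2real_leI)
qed

text \<open>If \<open>c < a + b\<close>, the removed triangles are isosceles with legs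
  \<open>(a + b - c) / 2\<close>, so together they have the area of one square. The hypothesis on
  \<open>\<bar>a - b\<bar>\<close> says that these legs fit into both sides of the
  rectangle.\<close>

lemma hex_area_eq:
  assumes "0 \<le> a" "0 \<le> b" "\<bar>a - b\<bar> \<le> c"
  shows "hex_area a b c = a * b - (max 0 ((a + b - c) / 2))\<^sup>2"
proof (cases "a + b \<le> c")
  case True
  then have "{(x::real, y::real). \<bar>x\<bar> \<le> a / 2 \<and> \<bar>y\<bar> \<le> b / 2 \<and> \<bar>x + y\<bar> \<le> c / 2}
      = {(x, y). \<bar>x\<bar> \<le> a / 2 \<and> \<bar>y\<bar> \<le> b / 2}"
    by (auto simp: abs_if split: if_splits)
  then have "hex_area a b c = a * b"
    unfolding hex_area_def by (simp only: measure_rectangle(2)[OF assms(1,2)])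
  then show ?thesis
    using True by simp
next
  case False
  define R where "R = {(x::real, y::real). \<bar>x\<bar> \<le> a / 2 \<and> \<bar>y\<bar> \<le> b / 2}"
  define T where "T = {(x::real, y::real). x \<le> a / 2 \<and> y \<le> b / 2 \<and> c / 2 < x + y}"
  define T' where "T' = uminus ` T"
  have T'_eq: "T' = {(x, y). - (a / 2) \<le> x \<and> - (b / 2) \<le> y \<and> x + y < - (c / 2)}"
    unfolding T'_def T_def image_uminus_eq by auto
  have R: "R \<in> fmeasurable lborel" "measure lborel R = a * b"
    using measure_rectangle[OF assms(1,2)] by (simp_all add: R_def)
  have T: "T \<in> sets borel"
    unfolding T_def by (rule sets_corner_triangle)
  have T': "T' \<in> sets borel"
    using measurable_sets[of uminus borel borel T] T by (simp add: T'_def image_uminus_eq vimage_def)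
  have "T \<union> T' \<subseteq> R"
    using assms unfolding R_def T_def T'_eq by auto
  moreover have "T \<inter> T' = {}"
    using assms unfolding T_def T'_eq by auto
  moreover have "{(x, y). \<bar>x\<bar> \<le> a / 2 \<and> \<bar>y\<bar> \<le> b / 2 \<and> \<bar>x + y\<bar> \<le> c / 2} = R - (T \<union> T')"
    unfolding R_def T_def T'_eq abs_le_iff by auto
  moreover have "T \<in> fmeasurable lborel" "T' \<in> fmeasurable lborel"
    using R(1) T T' \<open>T \<union> T' \<subseteq> R\<close> by (auto intro: fmeasurableI2)
  ultimately have "hex_area a b c = a * b - (measure lborel T + measure lborel T')"
    using R T T' unfolding hex_area_def
    by (simp add: measurable_measure_Diff measure_Un3)
  also have "measure lborel T' = measure lborel T"
    unfolding T'_def by (rule measure_lborel_uminus) (use T T' in \<open>simp_all add: T'_def\<close>)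
  also have "measure lborel T = ((a + b - c) / 2)\<^sup>2 / 2"
    using measure_corner_triangle[of "c / 2" "a / 2" "b / 2"] False
    by (simp add: T_def add_divide_distrib diff_divide_distrib)
  finally show ?thesis
    using False by simp
qed

lemma hex_area_diag:
  assumes "0 \<le> a" "0 \<le> c"
  shows "hex_area a a c = a\<^sup>2 - (max 0 (a - c / 2))\<^sup>2"
  using hex_area_eq[of a a c] assms by (simp add: power2_eq_square field_simps)

text \<open>This reduces the second maximum to densities that are constant on the residues 1 and 2.\<close>

lemma hex_area_le_diag_mean:
  assumes "0 \<le> a" "0 \<le> b" "0 \<le> c"
  shows "hex_area a b c \<le> ((a + b) / 2)\<^sup>2 - (max 0 ((a + b) / 2 - c / 2))\<^sup>2"
proof -
  have *: "hex_area a b c \<le> ((a + b) / 2)\<^sup>2 - (max 0 ((a + b) / 2 - c / 2))\<^sup>2"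
    if "0 \<le> b" "b \<le> a" "0 \<le> c" for a b
  proof (cases "a - b \<le> c")
    case True
    then have "hex_area a b c = a * b - (max 0 ((a + b) / 2 - c / 2))\<^sup>2"
      using that hex_area_eq[of a b c] by (simp add: diff_divide_distrib add_divide_distrib)
    \<comment> \<open>The subtracted square depends only on \<open>a + b\<close>, so AM-GM for the
      product suffices.\<close>
    moreover have "a * b \<le> ((a + b) / 2)\<^sup>2"
      using zero_le_power2[of "a - b"] by (simp add: power2_eq_square field_simps)
    ultimately show ?thesis
      by simp
  next
    case False
    \<comment> \<open>The right side minus the left side is
      \<open>c * (2 * (a - b) - c) / 4\<close>.\<close>
    have "b * c \<le> ((a + b) / 2)\<^sup>2 - ((a + b) / 2 - c / 2)\<^sup>2"
      using mult_nonneg_nonneg[of c "2 * (a - b) - c"] that False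
      by (simp add: power2_eq_square field_simps)
    then show ?thesis
      using hex_area_le_mult_third[of b c a] that False by simp
  qed
  show ?thesis
    using *[of b a] *[of a b] assms hex_area_commute[of a b c]
    by (cases "b \<le> a") (simp_all add: add.commute)
qed

section \<open>Sums over the residue solutions\<close>

text \<open>The third coefficient vanishes modulo 3, so \<open>r3\<close> is free.\<close>

lemma residue_solutions_3:
  "residue_solutions a b (s * 3) 3
    = {(r1, r2, r3) \<in> {0, 1, 2} \<times> {0, 1, 2} \<times> {0, 1, 2}. 3 dvd a * r1 + b * r2}"
proof -
  have "{0..<int 3} = {0, 1, 2}"
    by auto
  moreover have "[a * r1 + b * r2 + s * 3 * r3 = 0] (mod int 3) \<longleftrightarrow> 3 dvd a * r1 + b * r2" for r1 r2 r3
    by (simp add: cong_0_iff dvd_add_left_iff)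
  ultimately show ?thesis
    unfolding residue_solutions_def by simp
qed

lemma gamma_density_antidiagonal:
  assumes "s \<in> {1, - 1 :: int}"
  shows "gamma_density 1 (- 1) (s * 3) 3 g =
    (\<Sum>r\<in>{0, 1, 2}. \<Sum>t\<in>{0, 1, 2}. hex_area (g r) (g r) (3 * g t)) / 3"
proof -
  define A where "A = {0, 1, 2 :: int}"
  have "3 dvd 1 * r1 + - 1 * r2 \<longleftrightarrow> r1 = r2" if "r1 \<in> A" "r2 \<in> A" for r1 r2
    using that unfolding A_def by auto
  then have "residue_solutions 1 (- 1) (s * 3) 3 = (\<lambda>(r, t). (r, r, t)) ` (A \<times> A)"
    unfolding residue_solutions_3 A_def[symmetric] by auto
  moreover have "inj_on (\<lambda>(r, t). (r, r, t)) (A \<times> A)"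
    by (auto simp: inj_on_def)
  moreover have "1 / real_of_int \<bar>1 * - 1 * (s * 3)\<bar> = 1 / 3"
    using assms by auto
  ultimately show ?thesis
    unfolding gamma_density_def A_def[symmetric]
    by (simp add: sum.reindex sum.cartesian_product case_prod_unfold)
qed

lemma gamma_density_diagonal:
  assumes "s \<in> {1, - 1 :: int}"
  shows "gamma_density 1 1 (s * 3) 3 g =
    (\<Sum>t\<in>{0, 1, 2}. hex_area (g 0) (g 0) (3 * g t) + 2 * hex_area (g 1) (g 2) (3 * g t)) / 3"
proof -
  \<comment> \<open>\<open>P\<close> lists the solutions of r1 + r2 = 0 modulo 3; its last two pairs
    contribute equally by \<open>hex_area_commute\<close>, hence the factor 2.\<close>
  define A P where "A = {0, 1, 2 :: int}" and "P = {(0, 0), (1, 2), (2 :: int, 1 :: int)}"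
  have "P \<subseteq> A \<times> A"
    unfolding A_def P_def by simp
  moreover have "3 dvd 1 * r1 + 1 * r2 \<longleftrightarrow> (r1, r2) \<in> P" if "r1 \<in> A" "r2 \<in> A" for r1 r2
    using that unfolding A_def P_def by auto
  ultimately have "residue_solutions 1 1 (s * 3) 3 = (\<lambda>((q, r), t). (q, r, t)) ` (P \<times> A)"
    unfolding residue_solutions_3 A_def[symmetric] by force
  moreover have "inj_on (\<lambda>((q, r), t). (q, r, t)) (P \<times> A)"
    by (auto simp: inj_on_def)
  ultimately have "(\<Sum>(r1, r2, r3)\<in>residue_solutions 1 1 (s * 3) 3. hex_area (g r1) (g r2) (3 * g r3))
      = (\<Sum>(q, r)\<in>P. \<Sum>t\<in>A. hex_area (g q) (g r) (3 * g t))"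
    by (simp add: sum.reindex sum.cartesian_product case_prod_unfold)
  moreover have "1 / real_of_int \<bar>1 * 1 * (s * 3)\<bar> = 1 / 3" "real_of_int \<bar>s * 3\<bar> = 3"
    using assms by auto
  ultimately show ?thesis
    unfolding gamma_density_def A_def P_def using hex_area_commute[of "g 2" "g 1"]
    by (simp add: sum.distrib)
qed

lemma densities_3_iff:
  "g \<in> densities 3 \<longleftrightarrow> 0 \<le> g 0 \<and> 0 \<le> g 1 \<and> 0 \<le> g 2 \<and> g 0 + g 1 + g 2 = 1"
proof -
  have "{0..<int 3} = {0, 1, 2}"
    by auto
  then show ?thesis
    unfolding densities_def by (auto simp: add.assoc)
qed

section \<open>The quadratic optimization problems\<close>

text \<open>The difference of the two sides is positive semidefinite with kernel spanned by (42, 12, 7).\<close>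

lemma antidiagonal_bound_all_terms:
  fixes a b c :: real
  shows "a\<^sup>2 - b\<^sup>2 / 4 - 3/2 * c\<^sup>2 + 3 * (a * b + a * c + b * c) \<le> 141/122 * (a + b + c)\<^sup>2"
proof -
  \<comment> \<open>The form is the expansion of the sorted objective with all three positive parts
    active. The constant 141/122 is three times 47/122, homogenized by the square of the sum.
    Completing the square in \<open>a\<close> leaves a multiple of a square in \<open>b\<close> and
    \<open>c\<close>.\<close>
  have "141/122 * (a + b + c)\<^sup>2 - (a\<^sup>2 - b\<^sup>2 / 4 - 3/2 * c\<^sup>2 + 3 * (a * b + a * c + b * c))
      = 19/122 * (a - 42/19 * (b + c))\<^sup>2 + (7 * b - 12 * c)\<^sup>2 / 76"
    by (simp add: power2_eq_square field_simps)
  moreover have "\<dots> \<ge> 0"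
    by simp
  ultimately show ?thesis
    by linarith
qed

lemma antidiagonal_bound_two_terms:
  fixes a b c :: real
  assumes "b \<le> 3/2 * c" "c \<le> 3/2 * b"
  shows "3 * (a\<^sup>2 + b\<^sup>2 + c\<^sup>2) - (a - 3/2 * b)\<^sup>2 - (a - 3/2 * c)\<^sup>2 \<le> 141/122 * (a + b + c)\<^sup>2"
proof -
  \<comment> \<open>The same square in \<open>a\<close> splits off with factor 19/122; what remains
    is 6/25 times the product plus 9/1900 times \<open>(b + c)\<^sup>2\<close>.\<close>
  have "0 \<le> (3/2 * c - b) * (3/2 * b - c)" "0 \<le> (a - 42/19 * (b + c))\<^sup>2" "0 \<le> (b + c)\<^sup>2"
    using assms by simp_all
  then show ?thesis
    by (simp only: power2_eq_square algebra_simps)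
qed

lemma antidiagonal_bound_small_third:
  fixes a b c :: real
  assumes "b \<le> a" "a \<le> 3/2 * b" "3/2 * c \<le> b" "0 \<le> c"
  shows "3 * (a\<^sup>2 + b\<^sup>2 + c\<^sup>2) - (a - 3/2 * c)\<^sup>2 - (b - 3/2 * c)\<^sup>2 \<le> 141/122 * (a + b + c)\<^sup>2"
proof -
  have "0 \<le> a - b" "0 \<le> 3/2 * b - a" "0 \<le> b - 3/2 * c"
    using assms by simp_all
  note nonneg = this \<open>0 \<le> c\<close>
  \<comment> \<open>All pairwise products of the four nonnegative linear forms are supplied. Once
    expanded, the claim is linear in the monomials and is a nonnegative combination of these
    products.\<close>
  show ?thesis
    using nonneg[THEN mult_nonneg_nonneg, OF nonneg(1)] nonneg[THEN mult_nonneg_nonneg, OF nonneg(2)]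
      nonneg[THEN mult_nonneg_nonneg, OF nonneg(3)] nonneg[THEN mult_nonneg_nonneg, OF nonneg(4)]
    by (simp only: power2_eq_square algebra_simps)
qed

lemma antidiagonal_bound_one_term:
  fixes a b c :: real
  assumes "a \<le> 3/2 * b" "3/2 * c \<le> a" "b \<le> 3/2 * c"
  shows "3 * (a\<^sup>2 + b\<^sup>2 + c\<^sup>2) - (a - 3/2 * c)\<^sup>2 \<le> 141/122 * (a + b + c)\<^sup>2"
proof -
  have nonneg: "0 \<le> 3/2 * b - a" "0 \<le> a - 3/2 * c" "0 \<le> 3/2 * c - b"
    using assms by simp_all
  show ?thesis
    using nonneg[THEN mult_nonneg_nonneg, OF nonneg(1)] nonneg[THEN mult_nonneg_nonneg, OF nonneg(2)]
      nonneg[THEN mult_nonneg_nonneg, OF nonneg(3)]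
    by (simp only: power2_eq_square algebra_simps)
qed

lemma antidiagonal_bound_no_term:
  fixes a b c :: real
  assumes "b \<le> a" "c \<le> b" "a \<le> 3/2 * c"
  shows "3 * (a\<^sup>2 + b\<^sup>2 + c\<^sup>2) \<le> 141/122 * (a + b + c)\<^sup>2"
proof -
  have nonneg: "0 \<le> a - b" "0 \<le> b - c" "0 \<le> 3/2 * c - a"
    using assms by simp_all
  show ?thesis
    using nonneg[THEN mult_nonneg_nonneg, OF nonneg(1)] nonneg[THEN mult_nonneg_nonneg, OF nonneg(2)]
      nonneg[THEN mult_nonneg_nonneg, OF nonneg(3)]
    by (simp only: power2_eq_square algebra_simps)
qed

text \<open>Here \<open>p\<close> stands for the value at residue 0 and \<open>m\<close> for the
  mean of the values at 1 and 2; 15/13 is three times 5/13, and \<open>p + 2 * m\<close> is the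
  total mass.\<close>

lemma diagonal_bound:
  fixes p m :: real
  assumes "0 \<le> p" "0 \<le> m"
  shows "3 * p\<^sup>2 + 6 * m\<^sup>2 - 2 * (max 0 (p - 3/2 * m))\<^sup>2 - 2 * (max 0 (m - 3/2 * p))\<^sup>2
    \<le> 15/13 * (p + 2 * m)\<^sup>2"
proof -
  consider "3/2 * m \<le> p" | "3/2 * p \<le> m" | "p \<le> 3/2 * m" "m \<le> 3/2 * p"
    by linarith
  then show ?thesis
  proof cases
    case 1
    then have max: "max 0 (p - 3/2 * m) = p - 3/2 * m" "max 0 (m - 3/2 * p) = 0"
      using assms by simp_all
    \<comment> \<open>The difference of the two sides is this square divided by 26, so equality
      holds exactly for p : m = 9 : 2.\<close>
    have "0 \<le> (2 * p - 9 * m)\<^sup>2"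
      by simp
    then show ?thesis
      unfolding max by (simp only: power2_eq_square algebra_simps)
  next
    case 2
    then have max: "max 0 (p - 3/2 * m) = 0" "max 0 (m - 3/2 * p) = m - 3/2 * p"
      using assms by simp_all
    have "0 \<le> (2 * p - m)\<^sup>2" "0 \<le> m\<^sup>2" "0 \<le> p\<^sup>2"
      by simp_all
    then show ?thesis
      unfolding max by (simp only: power2_eq_square algebra_simps)
  next
    case 3
    then have max: "max 0 (p - 3/2 * m) = 0" "max 0 (m - 3/2 * p) = 0"
      by simp_all
    have "0 \<le> (3/2 * m - p) * (3/2 * p - m)" "0 \<le> p\<^sup>2" "0 \<le> m\<^sup>2" "0 \<le> p * m"
      using 3 assms by simp_all
    then show ?thesis
      unfolding max by (simp only: power2_eq_square algebra_simps)
  qed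
qed

lemma antidiagonal_bound_sorted:
  fixes a b c :: real
  assumes "0 \<le> c" "c \<le> b" "b \<le> a"
  shows "3 * (a\<^sup>2 + b\<^sup>2 + c\<^sup>2) - (max 0 (a - 3/2 * b))\<^sup>2 - (max 0 (a - 3/2 * c))\<^sup>2 - (max 0 (b - 3/2 * c))\<^sup>2
    \<le> 141/122 * (a + b + c)\<^sup>2"
proof -
  \<comment> \<open>The cells record which positive parts are active. Since
    \<open>a - 3/2 * c\<close> is active whenever one of the others is, five of the eight
    combinations remain. The maximizer lies in the first.\<close>
  consider "3/2 * b \<le> a" "3/2 * c \<le> b" | "3/2 * b \<le> a" "b \<le> 3/2 * c"
    | "a \<le> 3/2 * b" "3/2 * c \<le> b" | "a \<le> 3/2 * b" "b \<le> 3/2 * c" "3/2 * c \<le> a" | "a \<le> 3/2 * c"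
    using assms by linarith
  then show ?thesis
  proof cases
    case 1
    then have max: "max 0 (a - 3/2 * b) = a - 3/2 * b" "max 0 (a - 3/2 * c) = a - 3/2 * c" "max 0 (b - 3/2 * c) = b - 3/2 * c"
      using assms by simp_all
    show ?thesis
      unfolding max using antidiagonal_bound_all_terms[of a b c]
      by (simp only: power2_eq_square algebra_simps)
  next
    case 2
    then have max: "max 0 (a - 3/2 * b) = a - 3/2 * b" "max 0 (a - 3/2 * c) = a - 3/2 * c" "max 0 (b - 3/2 * c) = 0"
      using assms by simp_all
    show ?thesis
      unfolding max using antidiagonal_bound_two_terms[of b c a] 2 assms by simp
  next
    case 3
    then have max: "max 0 (a - 3/2 * b) = 0" "max 0 (a - 3/2 * c) = a - 3/2 * c" "max 0 (b - 3/2 * c) = b - 3/2 * c"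
      using assms by simp_all
    show ?thesis
      unfolding max using antidiagonal_bound_small_third[OF assms(3) 3 assms(1)] by simp
  next
    case 4
    then have max: "max 0 (a - 3/2 * b) = 0" "max 0 (a - 3/2 * c) = a - 3/2 * c" "max 0 (b - 3/2 * c) = 0"
      using assms by simp_all
    show ?thesis
      unfolding max using antidiagonal_bound_one_term[OF 4(1,3,2)] by simp
  next
    case 5
    then have max: "max 0 (a - 3/2 * b) = 0" "max 0 (a - 3/2 * c) = 0" "max 0 (b - 3/2 * c) = 0"
      using assms by simp_all
    show ?thesis
      unfolding max using antidiagonal_bound_no_term[OF assms(3,2) 5] by simp
  qed
qed

lemma antidiagonal_bound:
  fixes a b c :: real
  assumes "0 \<le> a" "0 \<le> b" "0 \<le> c" "a + b + c = 1"
  shows "3 * (a\<^sup>2 + b\<^sup>2 + c\<^sup>2)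
    - (max 0 (a - 3/2 * b))\<^sup>2 - (max 0 (a - 3/2 * c))\<^sup>2 - (max 0 (b - 3/2 * a))\<^sup>2
    - (max 0 (b - 3/2 * c))\<^sup>2 - (max 0 (c - 3/2 * a))\<^sup>2 - (max 0 (c - 3/2 * b))\<^sup>2 \<le> 141/122"
proof -
  define f :: "real \<Rightarrow> real \<Rightarrow> real" where "f x y = (max 0 (x - 3/2 * y))\<^sup>2" for x y
  have *: "3 * (x\<^sup>2 + y\<^sup>2 + z\<^sup>2) - f x y - f x z - f y z
      \<le> 141/122" if "0 \<le> z" "z \<le> y" "y \<le> x" "x + y + z = 1" for x y z :: real
    using antidiagonal_bound_sorted[OF that(1-3)] that(4) by (simp add: f_def)
  have sums: "a + b + c = 1" "a + c + b = 1" "b + c + a = 1" "b + a + c = 1" "c + b + a = 1" "c + a + b = 1"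
    using assms(4) by simp_all
  \<comment> \<open>In each ordering the three squares comparing a smaller value with a larger one
    are dropped, which can only increase the left side.\<close>
  have sq: "f x y \<ge> 0" for x y
    by (simp add: f_def)
  consider "c \<le> b" "b \<le> a" | "b \<le> c" "c \<le> a" | "a \<le> c" "c \<le> b"
    | "c \<le> a" "a \<le> b" | "a \<le> b" "b \<le> c" | "b \<le> a" "a \<le> c"
    by linarith
  then have "3 * (a\<^sup>2 + b\<^sup>2 + c\<^sup>2) - f a b - f a c - f b a - f b c - f c a - f c b \<le> 141/122"
  proof cases
    case 1
    show ?thesis
      using *[OF assms(3) 1 sums(1)] sq[of c b] sq[of c a] sq[of b a] by simp
  next
    case 2
    show ?thesis
      using *[OF assms(2) 2 sums(2)] sq[of b c] sq[of b a] sq[of c a] by simp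
  next
    case 3
    show ?thesis
      using *[OF assms(1) 3 sums(3)] sq[of a c] sq[of a b] sq[of c b] by simp
  next
    case 4
    show ?thesis
      using *[OF assms(3) 4 sums(4)] sq[of c a] sq[of c b] sq[of a b] by simp
  next
    case 5
    show ?thesis
      using *[OF assms(1) 5 sums(5)] sq[of a b] sq[of a c] sq[of b c] by simp
  next
    case 6
    show ?thesis
      using *[OF assms(2) 6 sums(6)] sq[of b a] sq[of b c] sq[of a c] by simp
  qed
  then show ?thesis
    by (simp add: f_def)
qed

section \<open>Attainment and upper bound for both coefficient patterns\<close>

theorem theorem1p7:
  fixes s :: int
  assumes "s \<in> {1, -1}"
  shows "is_gamma 1 (-1) (s * 3) 3 (47 / 122) \<and> is_gamma 1 1 (s * 3) 3 (5 / 13)"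
proof
  show "is_gamma 1 (-1) (s * 3) 3 (47 / 122)"
    unfolding is_gamma_def
  proof
    \<comment> \<open>The kernel vector (42, 12, 7) of the form in
      \<open>antidiagonal_bound_all_terms\<close>, scaled to total mass 1.\<close>
    define g :: "int \<Rightarrow> real" where "g = (\<lambda>r. if r = 0 then 42 / 61 else if r = 1 then 12 / 61 else 7 / 61)"
    have "g \<in> densities 3"
      by (simp add: densities_3_iff g_def)
    moreover have "gamma_density 1 (- 1) (s * 3) 3 g = 47 / 122"
      using assms by (simp add: gamma_density_antidiagonal hex_area_diag g_def power2_eq_square)
    ultimately show "47 / 122 \<in> gamma_density 1 (- 1) (s * 3) 3 ` densities 3"
      by force
    show "\<forall>g\<in>densities 3. gamma_density 1 (- 1) (s * 3) 3 g \<le> 47 / 122"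
    proof
      fix g
      assume "g \<in> densities 3"
      then have g: "0 \<le> g 0" "0 \<le> g 1" "0 \<le> g 2" "g 0 + g 1 + g 2 = 1"
        by (simp_all add: densities_3_iff)
      \<comment> \<open>Each \<open>(g r)\<^sup>2\<close> occurs once for every \<open>t\<close>;
        the terms with \<open>t = r\<close> lose nothing, as
        \<open>g r \<le> 3/2 * g r\<close>.\<close>
      have "gamma_density 1 (- 1) (s * 3) 3 g = (3 * ((g 0)\<^sup>2 + (g 1)\<^sup>2 + (g 2)\<^sup>2)
        - (max 0 (g 0 - 3/2 * g 1))\<^sup>2 - (max 0 (g 0 - 3/2 * g 2))\<^sup>2 - (max 0 (g 1 - 3/2 * g 0))\<^sup>2
        - (max 0 (g 1 - 3/2 * g 2))\<^sup>2 - (max 0 (g 2 - 3/2 * g 0))\<^sup>2 - (max 0 (g 2 - 3/2 * g 1))\<^sup>2) / 3"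
        using assms g by (simp add: gamma_density_antidiagonal hex_area_diag)
      then show "gamma_density 1 (- 1) (s * 3) 3 g \<le> 47 / 122"
        using antidiagonal_bound[OF g] by simp
    qed
  qed
  show "is_gamma 1 1 (s * 3) 3 (5 / 13)"
    unfolding is_gamma_def
  proof
    \<comment> \<open>The equality case 2p = 9m of \<open>diagonal_bound\<close> with p + 2m =
      1.\<close>
    define g :: "int \<Rightarrow> real" where "g = (\<lambda>r. if r = 0 then 9 / 13 else 2 / 13)"
    have "g \<in> densities 3"
      by (simp add: densities_3_iff g_def)
    moreover have "gamma_density 1 1 (s * 3) 3 g = 5 / 13"
      using assms by (simp add: gamma_density_diagonal hex_area_diag g_def power2_eq_square)
    ultimately show "5 / 13 \<in> gamma_density 1 1 (s * 3) 3 ` densities 3"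
      by force
    show "\<forall>g\<in>densities 3. gamma_density 1 1 (s * 3) 3 g \<le> 5 / 13"
    proof
      fix g
      assume "g \<in> densities 3"
      then have g: "0 \<le> g 0" "0 \<le> g 1" "0 \<le> g 2" "g 0 + g 1 + g 2 = 1"
        by (simp_all add: densities_3_iff)
      define p m where "p = g 0" and "m = (g 1 + g 2) / 2"
      then have pm: "0 \<le> p" "0 \<le> m" "p + 2 * m = 1"
        using g by simp_all
      have hex_0: "hex_area p p (3 * t) = p\<^sup>2 - (max 0 (p - 3/2 * t))\<^sup>2" if "0 \<le> t" for t
        using g that by (simp add: hex_area_diag p_def)
      \<comment> \<open>For \<open>t = g 1\<close> and \<open>t = g 2\<close> the subtracted square
        may be dropped: at the maximizer both values equal \<open>m\<close>, where it
        vanishes.\<close>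
      have "hex_area (g 1) (g 2) (3 * t) \<le> m\<^sup>2" if "0 \<le> t" for t
        using hex_area_le_diag_mean[of "g 1" "g 2" "3 * t"] g that
          zero_le_power2[of "max 0 (m - 3 * t / 2)"] unfolding m_def by linarith
      from this[OF g(2)] this[OF g(3)]
      have "hex_area (g 1) (g 2) (3 * g 1) \<le> m\<^sup>2" "hex_area (g 1) (g 2) (3 * g 2) \<le> m\<^sup>2" .
      moreover have "hex_area (g 1) (g 2) (3 * p) \<le> m\<^sup>2 - (max 0 (m - 3/2 * p))\<^sup>2"
        using hex_area_le_diag_mean[of "g 1" "g 2" "3 * p"] g by (simp add: m_def p_def)
      \<comment> \<open>Convexity of the squared positive part, at the midpoint \<open>m\<close> of
        \<open>g 1\<close> and \<open>g 2\<close>.\<close>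
      moreover have "2 * (max 0 (p - 3/2 * m))\<^sup>2 \<le> (max 0 (p - 3/2 * g 1))\<^sup>2 + (max 0 (p - 3/2 * g 2))\<^sup>2"
      proof -
        let ?x = "max 0 (p - 3/2 * g 1)" and ?y = "max 0 (p - 3/2 * g 2)"
        have "max 0 (p - 3/2 * m) \<le> (?x + ?y) / 2"
          unfolding m_def max_def by (auto simp: field_simps)
        then have "(max 0 (p - 3/2 * m))\<^sup>2 \<le> ((?x + ?y) / 2)\<^sup>2"
          by (intro power_mono) auto
        also have "2 * \<dots> \<le> ?x\<^sup>2 + ?y\<^sup>2"
          using zero_le_power2[of "?x - ?y"] by (simp add: power2_eq_square field_simps)
        finally show ?thesis
          by simp
      qed
      moreover have "3 * gamma_density 1 1 (s * 3) 3 g =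
          3 * p\<^sup>2 - (max 0 (p - 3/2 * g 1))\<^sup>2 - (max 0 (p - 3/2 * g 2))\<^sup>2
            + 2 * hex_area (g 1) (g 2) (3 * p) + 2 * hex_area (g 1) (g 2) (3 * g 1)
            + 2 * hex_area (g 1) (g 2) (3 * g 2)"
        using assms g hex_0[of p] hex_0[of "g 1"] hex_0[of "g 2"]
        by (simp add: gamma_density_diagonal flip: p_def)
      moreover have "3 * p\<^sup>2 + 6 * m\<^sup>2 - 2 * (max 0 (p - 3/2 * m))\<^sup>2 - 2 * (max 0 (m - 3/2 * p))\<^sup>2 \<le> 15/13"
        using diagonal_bound[OF pm(1,2)] pm(3) by simp
      ultimately show "gamma_density 1 1 (s * 3) 3 g \<le> 5 / 13"
        by linarith
    qed
  qed
qed

end
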